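(* Let $k \geq 1$ be a fixed integer, let $(c_n)_{n\ge1}$ be a sequence of real numbers with $c_n \to \infty$, and let $$p = p(n) = \left(\frac{(k+1)\log n + c_n}{n}\right)^{\frac{1}{k+2}}$$ be the edge probability of the random graph $G(n,p)$. Then with high probability $\widetilde{H}^i(\mathcal{N}(G(n,p))) = 0$ for all $i \leq k$.
   Context: $G(n,p)$ is the Erdős–Rényi random graph on $n$ vertices in which each edge of the complete graph is retained independently with probability $p\in[0,1]$ (where $p$ may depend on $n$). An event holds with high probability (w.h.p.) if its probability tends to $1$ as $n\to\infty$. The neighborhood complex $\mathcal{N}(G)$ of a graph $G$ with vertex set $V$ is the simplicial complex whose simplices are those subsets $\sigma\subset V$ whose elements have a common neighbor, i.e. there is a vertex of $G$ adjacent to every element of $\sigma$ (graphs are simple, so no vertex is adjacent to itself). $\widetilde{H}^i$ ($i\ge0$) denotes reduced simplicial cohomology with real coefficients. *)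

theory Defs
  imports "HOL-Probability.Probability" "HOL-Algebra.Elementary_Groups"
begin

text \<open>A simple graph is given by a vertex set \<open>V\<close> and a set \<open>E\<close> of two-element subsets of \<open>V\<close>.\<close>

definition complete_edges :: "'a set \<Rightarrow> 'a set set" where
  "complete_edges V = {e. e \<subseteq> V \<and> card e = 2}"

definition gnp :: "nat \<Rightarrow> real \<Rightarrow> nat set set pmf" where
  "gnp n p =
     map_pmf (\<lambda>f. {e \<in> complete_edges {..<n}. f e})
       (Pi_pmf (complete_edges {..<n}) False (\<lambda>_. bernoulli_pmf p))"

text \<open>As usual for augmented complexes, the empty set counts as a simplex (as soon as there is
  a vertex).\<close>

definition neighborhood_complex :: "'a set \<Rightarrow> 'a set set \<Rightarrow> 'a set set" where
  "neighborhood_complex V E = {\<sigma>. \<sigma> \<subseteq> V \<and> (\<exists>v\<in>V. \<forall>u\<in>\<sigma>. {u, v} \<in> E)}"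

text \<open>
  The augmented simplicial cochain complex with real coefficients of a simplicial complex \<open>K\<close>,
  each simplex being oriented by the linear order on the vertices.  It is indexed by the number
  \<open>m\<close> of vertices of a simplex, so index \<open>m\<close> is degree \<open>m - 1\<close>, and index \<open>0\<close> is the
  augmentation term, in degree \<open>-1\<close>.  A cochain is extended by \<open>0\<close> to sets that are not
  simplices of the right dimension.
\<close>

definition faces :: "'a set set \<Rightarrow> nat \<Rightarrow> 'a set set" where
  "faces K m = {\<sigma> \<in> K. finite \<sigma> \<and> card \<sigma> = m}"

definition cochain_group :: "'a set set \<Rightarrow> nat \<Rightarrow> ('a set \<Rightarrow> real) monoid" where
  "cochain_group K m =
     \<lparr>carrier = {f. \<forall>\<sigma>. \<sigma> \<notin> faces K m \<longrightarrow> f \<sigma> = 0},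
      mult = (\<lambda>f g \<sigma>. f \<sigma> + g \<sigma>),
      one = (\<lambda>\<sigma>. 0)\<rparr>"

text \<open>The exponent is the position of \<open>v\<close> in the increasing enumeration of \<open>\<sigma>\<close>, starting
  from \<open>0\<close>.\<close>

definition coboundary ::
    "'a::linorder set set \<Rightarrow> nat \<Rightarrow> ('a set \<Rightarrow> real) \<Rightarrow> ('a set \<Rightarrow> real)" where
  "coboundary K m f =
     (\<lambda>\<sigma>. if \<sigma> \<in> faces K (Suc m)
          then \<Sum>v\<in>\<sigma>. (- 1) ^ card {u \<in> \<sigma>. u < v} * f (\<sigma> - {v}) else 0)"

definition cocycles :: "'a::linorder set set \<Rightarrow> nat \<Rightarrow> ('a set \<Rightarrow> real) set" where
  "cocycles K m = kernel (cochain_group K m) (cochain_group K (Suc m)) (coboundary K m)"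

definition reduced_cohomology :: "nat \<Rightarrow> 'a::linorder set set \<Rightarrow> ('a set \<Rightarrow> real) set monoid" where
  "reduced_cohomology i K =
     (cochain_group K (i + 1))\<lparr>carrier := cocycles K (i + 1)\<rparr>
       Mod (coboundary K i ` carrier (cochain_group K i))"

end

theory Submission
  imports Defs
begin

text \<open>
  With high probability the neighborhood complex contains, through dimension \<open>k + 1\<close>, a cone with
  apex the vertex \<open>0\<close> over all of its simplices of dimension at most \<open>k\<close>, and such a cone kills
  the cohomology up to degree \<open>k\<close>.

  A set \<open>S\<close> of \<open>k + 2\<close> vertices is not a simplex with probability at most
  \<open>(1 - p ^ (k + 2)) ^ (n - k - 2)\<close>, because the vertices outside \<open>S\<close> are independently common
  neighbors of \<open>S\<close> (\<open>prob_not_simplex_le\<close>).  For the given \<open>p\<close> this is at most a constant times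
  \<open>n powr - (k + 1) * exp (- c n)\<close>.  Summed over all \<open>(k + 2)\<close>-sets the bound is of
  order \<open>n * exp (- c n)\<close>, which need not tend to \<open>0\<close>, so it does not yield the full
  \<open>(k + 1)\<close>-skeleton.  But at most \<open>n ^ (k + 1)\<close> of these sets contain the vertex \<open>0\<close>, and the
  expected number of non-simplices among them is at most \<open>exp (k + 2 - c n)\<close>
  (\<open>prob_star_incomplete_le\<close>, \<open>power_mult_one_minus_power_le\<close>), which tends to \<open>0\<close>.

  If all \<open>(k + 2)\<close>-sets containing \<open>0\<close> are simplices, then a cocycle \<open>f\<close> of degree at most \<open>k\<close>
  is the coboundary of \<open>\<tau> \<mapsto> f (insert 0 \<tau>)\<close>, by the cocycle condition on the simplices
  \<open>insert 0 \<sigma>\<close> (\<open>cone_cocycle_is_coboundary\<close>, \<open>trivial_cohomology_if_star_complete\<close>).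
\<close>

section \<open>The augmented cochain complex\<close>


lemma group_cochain_group: "group (cochain_group K m)"
proof (rule groupI)
  fix f assume f: "f \<in> carrier (cochain_group K m)"
  show "\<exists>g\<in>carrier (cochain_group K m). g \<otimes>\<^bsub>cochain_group K m\<^esub> f = \<one>\<^bsub>cochain_group K m\<^esub>"
    using f by (intro bexI[of _ "\<lambda>\<sigma>. - f \<sigma>"]) (auto simp: cochain_group_def)
qed (auto simp: cochain_group_def)

lemma coboundary_hom:
  "group_hom (cochain_group K m) (cochain_group K (Suc m)) (coboundary K m)"
proof -
  have "coboundary K m \<in> hom (cochain_group K m) (cochain_group K (Suc m))"
    by (auto simp: hom_def cochain_group_def coboundary_def sum.distrib algebra_simps fun_eq_iff)
  then show ?thesis
    by (simp add: group_hom_def group_hom_axioms_def group_cochain_group)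
qed

text \<open>
  Deleting a vertex shifts the positions of the larger vertices by one and leaves those of the
  smaller ones alone.  So the two orders of deleting \<open>u\<close> and \<open>v\<close> carry opposite signs.
\<close>

lemma coboundary_sign_swap:
  fixes u v :: "'a::linorder"
  assumes "finite \<sigma>" "u \<in> \<sigma>" "v \<in> \<sigma>" "u \<noteq> v"
  shows "(- 1 :: real) ^ card {w \<in> \<sigma>. w < v} * (- 1) ^ card {w \<in> \<sigma> - {v}. w < u} =
         - ((- 1) ^ card {w \<in> \<sigma>. w < u} * (- 1) ^ card {w \<in> \<sigma> - {u}. w < v})"
  using assms(2-4)
proof (induction u v rule: linorder_wlog)
  case (le u v)
  then have "u < v"
    by simp
  then have "{w \<in> \<sigma> - {v}. w < u} = {w \<in> \<sigma>. w < u}"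
    and "{w \<in> \<sigma>. w < v} = insert u {w \<in> \<sigma> - {u}. w < v}"
    using le by auto
  then show ?case
    using assms(1) by simp
next
  case (sym u v)
  then show ?case
    by simp
qed

lemma coboundary_coboundary:
  fixes K :: "'a::linorder set set"
  assumes down: "\<And>\<sigma> \<tau>. \<sigma> \<in> K \<Longrightarrow> \<tau> \<subseteq> \<sigma> \<Longrightarrow> \<tau> \<in> K"
  shows "coboundary K (Suc m) (coboundary K m f) = (\<lambda>\<sigma>. 0)"
proof
  fix \<sigma>
  show "coboundary K (Suc m) (coboundary K m f) \<sigma> = 0"
  proof (cases "\<sigma> \<in> faces K (Suc (Suc m))")
    case True
    then have fin: "finite \<sigma>" and card: "card \<sigma> = Suc (Suc m)" and K: "\<sigma> \<in> K"
      by (auto simp: faces_def)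
    define s :: "'a \<Rightarrow> 'a \<Rightarrow> real" where
      "s v u = (- 1) ^ card {w \<in> \<sigma>. w < v} * (- 1) ^ card {w \<in> \<sigma> - {v}. w < u}" for v u
    \<comment> \<open>Setting the diagonal to \<open>0\<close> lets both indices run over all of \<open>\<sigma>\<close>, so that the double sum
      is visibly the sum of an antisymmetric matrix.\<close>
    define t where "t v u = (if u = v then 0 else s v u * f (\<sigma> - {v, u}))" for v u
    have face: "\<sigma> - {v} \<in> faces K (Suc m)" if "v \<in> \<sigma>" for v
      using that fin card down[OF K, of "\<sigma> - {v}"] by (auto simp: faces_def)
    have inner: "(- 1) ^ card {w \<in> \<sigma>. w < v} * coboundary K m f (\<sigma> - {v}) = (\<Sum>u\<in>\<sigma>. t v u)"
      if v: "v \<in> \<sigma>" for v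
    proof -
      have "(- 1) ^ card {w \<in> \<sigma>. w < v} * coboundary K m f (\<sigma> - {v}) =
          (\<Sum>u\<in>\<sigma> - {v}. s v u * f (\<sigma> - {v} - {u}))"
        using face[OF v] by (simp add: coboundary_def s_def sum_distrib_left mult.assoc)
      also have "\<dots> = (\<Sum>u\<in>\<sigma> - {v}. t v u)"
        by (intro sum.cong) (auto simp: t_def Diff_insert2[symmetric] insert_commute)
      also have "\<dots> = (\<Sum>u\<in>\<sigma>. t v u)"
        using fin by (intro sum.mono_neutral_left) (auto simp: t_def)
      finally show ?thesis .
    qed
    have anti: "t v u = - t u v" if "u \<in> \<sigma>" "v \<in> \<sigma>" for u v
      using coboundary_sign_swap[OF fin that] by (auto simp: t_def s_def insert_commute)
    have "coboundary K (Suc m) (coboundary K m f) \<sigma> = (\<Sum>v\<in>\<sigma>. \<Sum>u\<in>\<sigma>. t v u)"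
      using True inner by (simp add: coboundary_def[of K "Suc m"])
    moreover have "(\<Sum>v\<in>\<sigma>. \<Sum>u\<in>\<sigma>. t v u) = - (\<Sum>v\<in>\<sigma>. \<Sum>u\<in>\<sigma>. t v u)"
    proof -
      have "(\<Sum>v\<in>\<sigma>. \<Sum>u\<in>\<sigma>. t v u) = (\<Sum>v\<in>\<sigma>. \<Sum>u\<in>\<sigma>. - t u v)"
        by (intro sum.cong refl anti)
      also have "\<dots> = - (\<Sum>v\<in>\<sigma>. \<Sum>u\<in>\<sigma>. t v u)"
        by (subst sum.swap) (simp add: sum_negf)
      finally show ?thesis .
    qed
    ultimately show ?thesis
      by simp
  qed (simp add: coboundary_def)
qed

text \<open>
  Closure under subsets puts the coboundaries among the cocycles; together with exactness this
  makes the cohomology the quotient of the group of cocycles by itself.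
\<close>

lemma trivial_reduced_cohomologyI:
  fixes K :: "'a::linorder set set"
  assumes down: "\<And>\<sigma> \<tau>. \<sigma> \<in> K \<Longrightarrow> \<tau> \<subseteq> \<sigma> \<Longrightarrow> \<tau> \<in> K"
    and exact: "\<And>f. f \<in> cocycles K (Suc i) \<Longrightarrow> f \<in> coboundary K i ` carrier (cochain_group K i)"
  shows "trivial_group (reduced_cohomology i K)"
proof -
  define Z where "Z = (cochain_group K (Suc i))\<lparr>carrier := cocycles K (Suc i)\<rparr>"
  have "coboundary K i g \<in> cocycles K (Suc i)" if "g \<in> carrier (cochain_group K i)" for g
    using group_hom.hom_closed[OF coboundary_hom that] coboundary_coboundary[of K i g, OF down]
    by (simp add: cocycles_def kernel_def cochain_group_def)
  then have "coboundary K i ` carrier (cochain_group K i) = cocycles K (Suc i)"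
    using exact by blast
  then have "reduced_cohomology i K = Z Mod carrier Z"
    by (simp add: reduced_cohomology_def Z_def)
  moreover have "group Z"
    unfolding Z_def cocycles_def
    by (intro group.subgroup_imp_group group_cochain_group
        group_hom.subgroup_kernel[OF coboundary_hom])
  moreover have "trivial_group (Z Mod carrier Z)" if "group Z"
  proof -
    interpret group Z
      by fact
    have "carrier Z \<lhd> Z"
      by (simp add: normal_inv_iff subgroup_self)
    then have "group (Z Mod carrier Z)"
      by (rule normal.factorgroup_is_group)
    moreover have "carrier (Z Mod carrier Z) = {carrier Z}"
      using coset_join2[OF _ subgroup_self] by (auto simp: carrier_FactGroup image_iff)
    ultimately show ?thesis
      by (simp add: trivial_group_def)
  qed
  ultimately show ?thesis
    by simp
qed

text \<open>
  Evaluating a cochain on \<open>insert a \<tau>\<close> is the usual contracting homotopy of a cone.  It needs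
  \<open>insert a \<sigma>\<close> to be a simplex just for the \<open>\<sigma>\<close> of the degree in question, since only there is the
  cocycle condition on \<open>insert a \<sigma>\<close> invoked.  Taking the apex \<open>a\<close> below all vertices puts it in
  position \<open>0\<close>, so that it contributes the sign \<open>+\<close> and raises all other positions by one.
\<close>

lemma cone_cocycle_is_coboundary:
  fixes K :: "'a::linorder set set"
  assumes down: "\<And>\<sigma> \<tau>. \<sigma> \<in> K \<Longrightarrow> \<tau> \<subseteq> \<sigma> \<Longrightarrow> \<tau> \<in> K"
    and least: "\<And>\<sigma> u. \<sigma> \<in> K \<Longrightarrow> u \<in> \<sigma> \<Longrightarrow> a \<le> u"
    and cone: "\<And>\<sigma>. \<sigma> \<in> faces K (Suc i) \<Longrightarrow> insert a \<sigma> \<in> K"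
    and f: "f \<in> cocycles K (Suc i)"
  shows "f \<in> coboundary K i ` carrier (cochain_group K i)"
proof
  define g where "g \<tau> = (if \<tau> \<in> faces K i \<and> a \<notin> \<tau> then f (insert a \<tau>) else 0)" for \<tau>
  show "g \<in> carrier (cochain_group K i)"
    by (auto simp: cochain_group_def g_def)
  have zero: "f \<sigma> = 0" if "\<sigma> \<notin> faces K (Suc i)" for \<sigma>
    using f that by (auto simp: cocycles_def kernel_def cochain_group_def)
  have df: "coboundary K (Suc i) f \<sigma> = 0" for \<sigma>
    using f by (auto simp: cocycles_def kernel_def cochain_group_def)
  show "f = coboundary K i g"
  proof
    fix \<sigma>
    show "f \<sigma> = coboundary K i g \<sigma>"
    proof (cases "\<sigma> \<in> faces K (Suc i)")
      case True
      then have fin: "finite \<sigma>" and card: "card \<sigma> = Suc i" and K: "\<sigma> \<in> K"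
        by (auto simp: faces_def)
      have face: "\<sigma> - {v} \<in> faces K i" if "v \<in> \<sigma>" for v
        using that fin card down[OF K, of "\<sigma> - {v}"] by (auto simp: faces_def)
      show ?thesis
      proof (cases "a \<in> \<sigma>")
        case a: True
        have pos_a: "card {u \<in> \<sigma>. u < a} = 0"
          using least[OF K] by (simp add: card_eq_0_iff) (auto dest: leD)
        \<comment> \<open>Only the face opposite to \<open>a\<close> survives, as \<open>g\<close> vanishes on sets containing \<open>a\<close>.\<close>
        have "coboundary K i g \<sigma> = (\<Sum>v\<in>\<sigma>. (- 1) ^ card {u \<in> \<sigma>. u < v} * g (\<sigma> - {v}))"
          using True by (simp add: coboundary_def)
        also have "\<dots> = (\<Sum>v\<in>{a}. (- 1) ^ card {u \<in> \<sigma>. u < v} * g (\<sigma> - {v}))"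
          using a fin by (intro sum.mono_neutral_right) (auto simp: g_def)
        also have "\<dots> = f \<sigma>"
          using a face[OF a] by (simp add: pos_a g_def insert_absorb)
        finally show ?thesis ..
      next
        case a: False
        have K': "insert a \<sigma> \<in> faces K (Suc (Suc i))"
          using cone[OF True] a fin card by (simp add: faces_def)
        have less: "a < v" if "v \<in> \<sigma>" for v
          using least[OF K that] that a by (metis order.not_eq_order_implies_strict)
        have pos_a: "card {u \<in> insert a \<sigma>. u < a} = 0"
          using less by (auto simp: card_eq_0_iff dest: less_asym)
        have pos: "card {u \<in> insert a \<sigma>. u < v} = Suc (card {u \<in> \<sigma>. u < v})" if "v \<in> \<sigma>" for v
        proof -
          have "{u \<in> insert a \<sigma>. u < v} = insert a {u \<in> \<sigma>. u < v}"
            using less[OF that] by auto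
          then show ?thesis
            using a fin by simp
        qed
        \<comment> \<open>The cocycle condition on \<open>insert a \<sigma>\<close> expresses \<open>f \<sigma>\<close> through the faces containing \<open>a\<close>.\<close>
        have "0 = (\<Sum>v\<in>insert a \<sigma>. (- 1) ^ card {u \<in> insert a \<sigma>. u < v} * f (insert a \<sigma> - {v}))"
          using df[of "insert a \<sigma>"] K' by (simp add: coboundary_def)
        also have "\<dots> = f \<sigma> + (\<Sum>v\<in>\<sigma>. (- 1) ^ card {u \<in> insert a \<sigma>. u < v} * f (insert a \<sigma> - {v}))"
          using a fin by (subst sum.insert) (simp_all only: pos_a, simp_all)
        also have "(\<Sum>v\<in>\<sigma>. (- 1) ^ card {u \<in> insert a \<sigma>. u < v} * f (insert a \<sigma> - {v})) =
            (\<Sum>v\<in>\<sigma>. - ((- 1) ^ card {u \<in> \<sigma>. u < v} * g (\<sigma> - {v})))"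
        proof (rule sum.cong[OF refl])
          fix v assume v: "v \<in> \<sigma>"
          then have "insert a \<sigma> - {v} = insert a (\<sigma> - {v})"
            using a by auto
          then show "(- 1) ^ card {u \<in> insert a \<sigma>. u < v} * f (insert a \<sigma> - {v}) =
              - ((- 1) ^ card {u \<in> \<sigma>. u < v} * g (\<sigma> - {v}))"
            using a face[OF v] by (simp only: pos[OF v]) (simp add: g_def)
        qed
        also have "\<dots> = - coboundary K i g \<sigma>"
          using True by (simp add: coboundary_def sum_negf)
        finally show ?thesis
          by simp
      qed
    qed (simp add: zero coboundary_def)
  qed
qed

section \<open>Sets without a common neighbor\<close>


text \<open>
  Disjoint blocks of coordinates are independent.  The proof splits one block off at a time, which
  writes the product measure as a product of two.
\<close>

lemma prob_every_block_defective:
  fixes p :: real and A :: "'a set" and B :: "'b \<Rightarrow> 'a set"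
  assumes "finite W" "finite A" "\<And>w. w \<in> W \<Longrightarrow> B w \<subseteq> A" "disjoint_family_on B W"
    and p: "0 \<le> p" "p \<le> 1"
  shows "measure_pmf.prob (Pi_pmf A False (\<lambda>_. bernoulli_pmf p)) {f. \<forall>w\<in>W. \<exists>e\<in>B w. \<not> f e} =
         (\<Prod>w\<in>W. 1 - p ^ card (B w))"
  using assms(1-4)
proof (induction W arbitrary: A rule: finite_induct)
  case empty
  then show ?case
    by simp
next
  case (insert w W)
  define P where "P C = Pi_pmf C False (\<lambda>_. bernoulli_pmf p)" for C :: "'a set"
  define X where "X = {f. \<exists>e\<in>B w. \<not> f e}"
  define Y where "Y = {f. \<forall>w\<in>W. \<exists>e\<in>B w. \<not> f e}"
  have fin: "finite (B w)" and sub: "B w \<subseteq> A"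
    using insert.prems by (auto intro: finite_subset)
  have disj: "B w \<inter> B v = {}" if "v \<in> W" for v
    using insert.prems(3) insert.hyps(2) that by (auto simp: disjoint_family_on_def)
  have "P A = map_pmf (\<lambda>(f, g) e. if e \<in> B w then f e else g e) (pair_pmf (P (B w)) (P (A - B w)))"
    using Pi_pmf_union[of "B w" "A - B w" False "\<lambda>_. bernoulli_pmf p"] fin sub insert.prems(1)
    by (simp add: P_def Un_absorb1)
  moreover have "(\<lambda>(f, g) e. if e \<in> B w then f e else g e) -`
      {f. \<forall>v\<in>insert w W. \<exists>e\<in>B v. \<not> f e} = X \<times> Y"
  proof -
    have *: "(\<exists>e\<in>B v. \<not> (if e \<in> B w then f e else g e)) \<longleftrightarrow> (\<exists>e\<in>B v. \<not> g e)"
      if "v \<in> W" for v and f g :: "'a \<Rightarrow> bool"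
      using disj[OF that] by (intro bex_cong) auto
    have "(\<forall>v\<in>insert w W. \<exists>e\<in>B v. \<not> (if e \<in> B w then f e else g e)) \<longleftrightarrow>
        (\<exists>e\<in>B w. \<not> f e) \<and> (\<forall>v\<in>W. \<exists>e\<in>B v. \<not> g e)" for f g :: "'a \<Rightarrow> bool"
      by (simp add: * cong: ball_cong bex_cong del: if_split if_image_distrib)
    then show ?thesis
      by (simp only: X_def Y_def set_eq_iff vimage_eq mem_Collect_eq split_paired_All split_beta
          fst_conv snd_conv mem_Times_iff simp_thms)
  qed
  ultimately have "measure_pmf.prob (P A) {f. \<forall>v\<in>insert w W. \<exists>e\<in>B v. \<not> f e} =
      measure_pmf.prob (pair_pmf (P (B w)) (P (A - B w))) (X \<times> Y)"
    by simp
  \<comment> \<open>\<open>X\<close> and \<open>Y\<close> may be uncountable; the product formula is applied to their intersections with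
    the countable supports.\<close>
  also have "\<dots> = measure_pmf.prob (pair_pmf (P (B w)) (P (A - B w)))
      ((X \<inter> set_pmf (P (B w))) \<times> (Y \<inter> set_pmf (P (A - B w))))"
    by (subst measure_Int_set_pmf[symmetric]) (simp add: Times_Int_Times)
  also have "\<dots> = measure_pmf.prob (P (B w)) X * measure_pmf.prob (P (A - B w)) Y"
    by (subst measure_pmf_prob_product) (auto simp: measure_Int_set_pmf)
  also have "measure_pmf.prob (P (A - B w)) Y = (\<Prod>v\<in>W. 1 - p ^ card (B v))"
    unfolding P_def Y_def
  proof (rule insert.IH)
    show "B v \<subseteq> A - B w" if "v \<in> W" for v
      using insert.prems(2)[of v] disj[OF that] that by blast
  qed (use insert.prems in \<open>auto simp: disjoint_family_on_def\<close>)
  also have "measure_pmf.prob (P (B w)) X = 1 - p ^ card (B w)"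
  proof -
    have "measure_pmf.prob (P (B w)) (Pi (B w) (\<lambda>_. {True})) = p ^ card (B w)"
      unfolding P_def using fin p by (simp add: measure_Pi_pmf_Pi measure_pmf_single)
    moreover have "X = UNIV - Pi (B w) (\<lambda>_. {True})"
      by (auto simp: X_def Pi_def)
    ultimately show ?thesis
      using measure_pmf.prob_compl[of "Pi (B w) (\<lambda>_. {True})" "P (B w)"] by simp
  qed
  finally show ?case
    using insert.hyps by (simp add: P_def)
qed

text \<open>
  A vertex \<open>w\<close> outside \<open>S\<close> is a common neighbor of \<open>S\<close> iff the block of edges joining it to \<open>S\<close> is
  present, and the blocks of different \<open>w\<close> are disjoint.
\<close>

lemma prob_not_simplex_le:
  assumes S: "S \<subseteq> {..<n}" and p: "0 \<le> p" "p \<le> 1"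
  shows "measure_pmf.prob (gnp n p) {E. S \<notin> neighborhood_complex {..<n} E} \<le>
         (1 - p ^ card S) ^ (n - card S)"
proof -
  define W where "W = {..<n} - S"
  define B where "B w = (\<lambda>u. {u, w}) ` S" for w :: nat
  have edges: "B w \<subseteq> complete_edges {..<n}" if "w \<in> W" for w
    using that S by (auto simp: B_def W_def complete_edges_def card_2_iff)
  have disj: "disjoint_family_on B W"
    by (auto simp: disjoint_family_on_def B_def W_def doubleton_eq_iff)
  have card_B: "card (B w) = card S" for w
    unfolding B_def by (intro card_image inj_onI) (auto simp: doubleton_eq_iff)
  have fin_W: "finite W"
    by (simp add: W_def)
  have card_W: "card W = n - card S"
    using S by (simp add: W_def card_Diff_subset finite_subset)
  have fin: "finite (complete_edges {..<n})"
    by (rule finite_subset[of _ "Pow {..<n}"]) (auto simp: complete_edges_def)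
  have "measure_pmf.prob (gnp n p) {E. S \<notin> neighborhood_complex {..<n} E} \<le>
      measure_pmf.prob (Pi_pmf (complete_edges {..<n}) False (\<lambda>_. bernoulli_pmf p))
        {f. \<forall>w\<in>W. \<exists>e\<in>B w. \<not> f e}"
    unfolding gnp_def measure_map_pmf
  proof (rule measure_pmf.finite_measure_mono)
    show "(\<lambda>f. {e \<in> complete_edges {..<n}. f e}) -` {E. S \<notin> neighborhood_complex {..<n} E}
        \<subseteq> {f. \<forall>w\<in>W. \<exists>e\<in>B w. \<not> f e}"
    proof clarsimp
      fix f w
      assume bad: "S \<notin> neighborhood_complex {..<n} {e \<in> complete_edges {..<n}. f e}" and w: "w \<in> W"
      have "w < n"
        using w by (simp add: W_def)
      with bad S obtain u where "u \<in> S" "\<not> ({u, w} \<in> complete_edges {..<n} \<and> f {u, w})"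
        unfolding neighborhood_complex_def by blast
      then show "\<exists>e\<in>B w. \<not> f e"
        using edges[OF w] by (auto simp: B_def)
    qed
  qed simp
  also have "\<dots> = (1 - p ^ card S) ^ (n - card S)"
    using prob_every_block_defective[OF _ fin edges disj p] by (simp add: fin_W card_B card_W)
  finally show ?thesis .
qed

text \<open>
  A union bound.  Prescribing the vertex \<open>a\<close> saves one power of \<open>n\<close> in the number of sets.
\<close>

lemma prob_star_incomplete_le:
  assumes p: "0 \<le> p" "p \<le> 1"
  shows "measure_pmf.prob (gnp n p)
           {E. \<exists>S\<subseteq>{..<n}. a \<in> S \<and> card S = Suc m \<and> S \<notin> neighborhood_complex {..<n} E} \<le>
         real n ^ m * (1 - p ^ Suc m) ^ (n - Suc m)"
proof -
  define \<S> where "\<S> = {S. S \<subseteq> {..<n} \<and> a \<in> S \<and> card S = Suc m}"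
  have fin: "finite \<S>"
    by (rule finite_subset[of _ "Pow {..<n}"]) (auto simp: \<S>_def)
  have "\<S> \<subseteq> insert a ` {T. T \<subseteq> {..<n} \<and> card T = m}"
  proof
    fix S assume "S \<in> \<S>"
    then have "S = insert a (S - {a})" "S - {a} \<subseteq> {..<n}" "card (S - {a}) = m"
      by (auto simp: \<S>_def finite_subset)
    then show "S \<in> insert a ` {T. T \<subseteq> {..<n} \<and> card T = m}"
      by blast
  qed
  then have "card \<S> \<le> card {T. T \<subseteq> {..<n} \<and> card T = m}"
    by (rule surj_card_le[rotated]) simp
  also have "\<dots> = n choose m"
    by (simp add: n_subsets)
  also have "\<dots> \<le> n ^ m"
    by (cases "m \<le> n") (auto intro: binomial_le_pow simp: binomial_eq_0)
  finally have "real (card \<S>) \<le> real n ^ m"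
    by (metis of_nat_le_iff of_nat_power)
  moreover have "measure_pmf.prob (gnp n p)
      {E. \<exists>S\<subseteq>{..<n}. a \<in> S \<and> card S = Suc m \<and> S \<notin> neighborhood_complex {..<n} E} \<le>
      real (card \<S>) * (1 - p ^ Suc m) ^ (n - Suc m)"
  proof -
    have "{E. \<exists>S\<subseteq>{..<n}. a \<in> S \<and> card S = Suc m \<and> S \<notin> neighborhood_complex {..<n} E} =
        (\<Union>S\<in>\<S>. {E. S \<notin> neighborhood_complex {..<n} E})"
      by (auto simp: \<S>_def)
    also have "measure_pmf.prob (gnp n p) \<dots> \<le>
        (\<Sum>S\<in>\<S>. measure_pmf.prob (gnp n p) {E. S \<notin> neighborhood_complex {..<n} E})"
      using fin by (intro measure_pmf.finite_measure_subadditive_finite) auto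
    also have "\<dots> \<le> (\<Sum>S\<in>\<S>. (1 - p ^ Suc m) ^ (n - Suc m))"
    proof (rule sum_mono)
      fix S assume "S \<in> \<S>"
      then show "measure_pmf.prob (gnp n p) {E. S \<notin> neighborhood_complex {..<n} E}
          \<le> (1 - p ^ Suc m) ^ (n - Suc m)"
        using prob_not_simplex_le[of S n p] p by (simp add: \<S>_def)
    qed
    finally show ?thesis
      by simp
  qed
  moreover have "0 \<le> (1 - p ^ Suc m) ^ (n - Suc m)"
    using p by (intro zero_le_power) (simp add: power_le_one del: power_Suc)
  ultimately show ?thesis
    by (meson mult_right_mono order_trans)
qed

section \<open>Vanishing of the cohomology\<close>


text \<open>
  A set of at most \<open>m\<close> vertices, once \<open>0\<close> is added to it, extends to a set of \<open>Suc m\<close> vertices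
  containing \<open>0\<close>, and the complex is closed under subsets.  So the cone condition with apex \<open>0\<close>
  holds for all simplices with at most \<open>m\<close> vertices, which are those of degree less than \<open>m\<close>.
\<close>

lemma trivial_cohomology_if_star_complete:
  assumes n: "Suc m \<le> n" and i: "i < m"
    and star: "\<And>S. S \<subseteq> {..<n} \<Longrightarrow> 0 \<in> S \<Longrightarrow> card S = Suc m \<Longrightarrow>
      S \<in> neighborhood_complex {..<n} E"
  shows "trivial_group (reduced_cohomology i (neighborhood_complex {..<n} E))"
proof -
  define K where "K = neighborhood_complex {..<n} E"
  have down: "\<tau> \<in> K" if "\<sigma> \<in> K" "\<tau> \<subseteq> \<sigma>" for \<sigma> \<tau>
    using that unfolding K_def neighborhood_complex_def by blast
  have cone: "insert 0 \<sigma> \<in> K" if \<sigma>: "\<sigma> \<in> faces K (Suc i)" for \<sigma>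
  proof -
    have "insert 0 \<sigma> \<subseteq> {..<n}"
      using \<sigma> n by (auto simp: faces_def K_def neighborhood_complex_def)
    moreover have "card (insert 0 \<sigma>) \<le> Suc m"
      using \<sigma> i card_insert_le_m1[of "Suc m" \<sigma> 0] by (auto simp: faces_def)
    ultimately obtain S where "insert 0 \<sigma> \<subseteq> S" "S \<subseteq> {..<n}" "card S = Suc m"
      using exists_subset_between[of "insert 0 \<sigma>" "Suc m" "{..<n}"] n by auto
    then show ?thesis
      using star[of S] down[of S "insert 0 \<sigma>"] by (simp add: K_def)
  qed
  have "trivial_group (reduced_cohomology i K)"
  proof (rule trivial_reduced_cohomologyI)
    show "f \<in> coboundary K i ` carrier (cochain_group K i)" if "f \<in> cocycles K (Suc i)" for f
      using down cone that by (intro cone_cocycle_is_coboundary[where a = 0]) auto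
  qed (rule down)
  then show ?thesis
    by (simp only: K_def)
qed

text \<open>
  The value of \<open>q\<close> makes \<open>exp (- q n)\<close> cancel the factor \<open>n ^ m\<close> exactly and leave \<open>exp (- c)\<close>.
  The exponent is \<open>n - Suc m\<close> rather than \<open>n\<close>, which costs at most the constant factor
  \<open>exp (Suc m)\<close>, because \<open>q \<le> 1\<close>.
\<close>

lemma power_mult_one_minus_power_le:
  fixes c :: real and m n :: nat
  defines "q \<equiv> (real m * ln (real n) + c) / real n"
  assumes n: "n \<ge> 1" and q: "0 \<le> q" "q \<le> 1"
  shows "real n ^ m * (1 - q) ^ (n - Suc m) \<le> exp (real (Suc m) - c)"
proof -
  have "(1 - q) ^ (n - Suc m) \<le> exp (- q) ^ (n - Suc m)"
    using q exp_ge_add_one_self[of "- q"] by (intro power_mono) auto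
  also have "\<dots> = exp (- (q * real (n - Suc m)))"
    by (simp add: exp_of_nat_mult[symmetric] mult.commute)
  also have "\<dots> \<le> exp (real (Suc m) - (real m * ln (real n) + c))"
  proof -
    have "q * (real n - real (Suc m)) \<le> q * real (n - Suc m)"
      using q by (intro mult_left_mono) auto
    moreover have "q * real n = real m * ln (real n) + c"
      using n by (simp add: q_def)
    moreover have "q * real (Suc m) \<le> real (Suc m)"
      using q by (intro mult_left_le_one_le) auto
    ultimately show ?thesis
      unfolding right_diff_distrib exp_le_cancel_iff by linarith
  qed
  finally have "real n ^ m * (1 - q) ^ (n - Suc m) \<le>
      real n ^ m * exp (real (Suc m) - (real m * ln (real n) + c))"
    by (intro mult_left_mono) auto
  also have "\<dots> = exp (real m * ln (real n)) * exp (real (Suc m) - (real m * ln (real n) + c))"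
    using n by (simp add: exp_of_nat_mult)
  also have "\<dots> = exp (real (Suc m) - c)"
    unfolding mult_exp_exp by simp
  finally show ?thesis .
qed

theorem theorem1p8:
  fixes k :: nat and c p :: "nat \<Rightarrow> real"
  assumes "k \<ge> 1"
    and "filterlim c at_top sequentially"
    and "\<And>n. n \<ge> 1 \<Longrightarrow> p n = (((real k + 1) * ln (real n) + c n) / real n) powr (1 / (real k + 2))"
    and "\<forall>\<^sub>F n in sequentially. 0 \<le> p n \<and> p n \<le> 1"
  shows "(\<lambda>n. measure_pmf.prob (gnp n (p n))
            {E. \<forall>i\<le>k. trivial_group (reduced_cohomology i (neighborhood_complex {..<n} E))})
         \<longlonglongrightarrow> 1"
proof (rule tendsto_sandwich)
  let ?good = "\<lambda>n. {E. \<forall>i\<le>k. trivial_group (reduced_cohomology i (neighborhood_complex {..<n} E))}"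
  let ?prob = "\<lambda>n. measure_pmf.prob (gnp n (p n)) (?good n)"
  have "\<forall>\<^sub>F n in sequentially. 0 \<le> c n"
    using assms(2) by (auto simp: filterlim_at_top)
  then show "\<forall>\<^sub>F n in sequentially. 1 - exp (real (k + 2) - c n) \<le> ?prob n"
    using assms(4) eventually_ge_at_top[of "k + 2"]
  proof eventually_elim
    case (elim n)
    define q where "q = (real (Suc k) * ln (real n) + c n) / real n"
    define bad where "bad = {E. \<exists>S\<subseteq>{..<n}. 0 \<in> S \<and> card S = Suc (Suc k) \<and>
      S \<notin> neighborhood_complex {..<n} E}"
    have n: "n \<ge> 2" and p: "0 \<le> p n" "p n \<le> 1"
      using elim by auto
    \<comment> \<open>For a negative base \<open>powr\<close> does not give a root; \<open>c n \<ge> 0\<close> excludes this case.\<close>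
    have "q > 0"
      unfolding q_def using n elim
      by (intro divide_pos_pos add_pos_nonneg mult_pos_pos ln_gt_zero) auto
    have "p n = q powr (1 / real (Suc (Suc k)))"
      using assms(3)[of n] n by (simp add: q_def add.commute)
    then have "p n ^ Suc (Suc k) = q powr (1 / real (Suc (Suc k)) * real (Suc (Suc k)))"
      using \<open>q > 0\<close> by (simp only: powr_powr[symmetric] powr_realpow powr_gt_zero)
    then have pq: "p n ^ Suc (Suc k) = q"
      using \<open>q > 0\<close> by (simp del: of_nat_Suc)
    have "q \<le> 1"
      using p power_le_one[of "p n" "Suc (Suc k)"] unfolding pq by simp
    have "measure_pmf.prob (gnp n (p n)) bad \<le> real n ^ Suc k * (1 - q) ^ (n - Suc (Suc k))"
      using prob_star_incomplete_le[OF p, of n 0 "Suc k"] unfolding pq bad_def .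
    also have "\<dots> \<le> exp (real (k + 2) - c n)"
      using power_mult_one_minus_power_le[of n "Suc k" "c n"] n \<open>q > 0\<close> \<open>q \<le> 1\<close>
      unfolding q_def[symmetric] by (simp del: power_Suc of_nat_Suc)
    finally have "1 - exp (real (k + 2) - c n) \<le> 1 - measure_pmf.prob (gnp n (p n)) bad"
      by simp
    also have "\<dots> = measure_pmf.prob (gnp n (p n)) (- bad)"
      using measure_pmf.prob_compl[of bad "gnp n (p n)"] by (simp add: Compl_eq_Diff_UNIV)
    also have "\<dots> \<le> ?prob n"
    proof (rule measure_pmf.finite_measure_mono)
      show "- bad \<subseteq> ?good n"
        using elim by (auto simp: bad_def intro!: trivial_cohomology_if_star_complete[of "Suc k"])
    qed simp
    finally show ?case .
  qed
  show "(\<lambda>n. 1 - exp (real (k + 2) - c n)) \<longlonglongrightarrow> 1"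
  proof -
    have "filterlim (\<lambda>n. real (k + 2) - c n) at_bot sequentially"
      using filterlim_tendsto_add_at_top[OF tendsto_const[of "- real (k + 2)"] assms(2)]
      by (simp add: filterlim_uminus_at_bot algebra_simps)
    then have "(\<lambda>n. exp (real (k + 2) - c n)) \<longlonglongrightarrow> 0"
      by (rule filterlim_compose[OF exp_at_bot])
    then show ?thesis
      using tendsto_diff[OF tendsto_const, of _ 0 sequentially 1] by simp
  qed
qed (auto intro: tendsto_const)

end
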